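(* Let $n\geq 3$ be an integer, and let $\mathcal{E}_n$, $\mathcal{H}_n$, $\mathcal{S}_n$ be the sets of polynomials in the variables $x_{ij}$ ($1\le i<j\le n$) and $y$ defined as follows. (1) $f\in\mathcal{E}_n$ if and only if $f(|P_iP_j|_e,\, r_e)=0$ for any $n$ points $P_1,\dots,P_n$ on a circle of any radius $r_e$ on the Euclidean plane. (2) $f\in\mathcal{H}_n$ if and only if $f(\sinh\frac{|P_iP_j|_h}{2},\, \frac12\sinh r_h)=0$ for any $n$ points $P_1,\dots,P_n$ on a circle of any radius $r_h$ on the hyperbolic plane. (3) $f\in\mathcal{S}_n$ if and only if $f(\sin\frac{|P_iP_j|_s}{2},\, \frac12\sin r_s)=0$ for any $n$ points $P_1,\dots,P_n$ on a circle of any radius $r_s$ on the unit sphere. Then $$\mathcal{E}_n=\mathcal{H}_n=\mathcal{S}_n.$$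
   Context: Polynomials have real coefficients. The notation $f(a_{ij},b)$ means that the value $a_{ij}$ is substituted for the variable $x_{ij}$, for all $1\le i<j\le n$, and $b$ is substituted for $y$. $|PQ|_e$, $|PQ|_h$, $|PQ|_s$ denote respectively the Euclidean distance in the plane, the hyperbolic distance in the hyperbolic plane (curvature $-1$), and the spherical (geodesic) distance on the unit sphere $\{(x,y,z):x^2+y^2+z^2=1\}$ (curvature $1$). A circle of radius $r$ is the set of points at distance $r$ from a given center in the respective geometry; radii are positive, and on the sphere $0<r_s<\pi$. *)

theory Defs
  imports "HOL-Analysis.Analysis" "HOL-Library.Poly_Mapping"
begin

datatype pvar = X nat nat | Y

(* A monomial maps each variable to its exponent. *)
type_synonym real_mpoly = "(pvar \<Rightarrow>\<^sub>0 nat) \<Rightarrow>\<^sub>0 real"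

definition mpoly_vars :: "real_mpoly \<Rightarrow> pvar set" where
  "mpoly_vars f = (\<Union>m \<in> Poly_Mapping.keys f. Poly_Mapping.keys m)"

definition polys :: "nat \<Rightarrow> real_mpoly set" where
  "polys n = {f. mpoly_vars f \<subseteq> insert Y {X i j | i j. 1 \<le> i \<and> i < j \<and> j \<le> n}}"

(* f(a_ij, b): the values of a outside 1 <= i < j <= n are irrelevant for f in polys n. *)
definition mpoly_eval :: "real_mpoly \<Rightarrow> (nat \<Rightarrow> nat \<Rightarrow> real) \<Rightarrow> real \<Rightarrow> real" where
  "mpoly_eval f a b =
     (\<Sum>m \<in> Poly_Mapping.keys f. Poly_Mapping.lookup f m *
        (\<Prod>v \<in> Poly_Mapping.keys m.
           (case v of X i j \<Rightarrow> a i j | Y \<Rightarrow> b) ^ Poly_Mapping.lookup m v))"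

(* The hyperbolic plane as the upper half-plane; hyp_dist is the distance of the
   metric (dx^2 + dy^2) / y^2, which has curvature -1. *)
definition hyp_plane :: "complex set" where
  "hyp_plane = {z. Im z > 0}"

definition hyp_dist :: "complex \<Rightarrow> complex \<Rightarrow> real" where
  "hyp_dist z w = arcosh (1 + (cmod (z - w))\<^sup>2 / (2 * Im z * Im w))"

definition hyp_circle :: "complex \<Rightarrow> real \<Rightarrow> complex set" where
  "hyp_circle c r = {z \<in> hyp_plane. hyp_dist c z = r}"

definition unit_sphere :: "(real ^ 3) set" where
  "unit_sphere = sphere 0 1"

(* Great-circle distance: the angle between two unit vectors. *)
definition sph_dist :: "real ^ 3 \<Rightarrow> real ^ 3 \<Rightarrow> real" where
  "sph_dist p q = arccos (p \<bullet> q)"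

definition sph_circle :: "real ^ 3 \<Rightarrow> real \<Rightarrow> (real ^ 3) set" where
  "sph_circle c r = {p \<in> unit_sphere. sph_dist c p = r}"

(* In real ^ 2 the library's sphere c r is the circle with center c and radius r. *)
definition euclidean_polys :: "nat \<Rightarrow> real_mpoly set" where
  "euclidean_polys n = {f \<in> polys n.
     \<forall>(c :: real ^ 2) r P. r > 0 \<and> (\<forall>i \<in> {1..n}. P i \<in> sphere c r) \<longrightarrow>
       mpoly_eval f (\<lambda>i j. dist (P i) (P j)) r = 0}"

definition hyperbolic_polys :: "nat \<Rightarrow> real_mpoly set" where
  "hyperbolic_polys n = {f \<in> polys n.
     \<forall>c \<in> hyp_plane. \<forall>r P. r > 0 \<and> (\<forall>i \<in> {1..n}. P i \<in> hyp_circle c r) \<longrightarrow>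
       mpoly_eval f (\<lambda>i j. sinh (hyp_dist (P i) (P j) / 2)) (sinh r / 2) = 0}"

definition spherical_polys :: "nat \<Rightarrow> real_mpoly set" where
  "spherical_polys n = {f \<in> polys n.
     \<forall>c \<in> unit_sphere. \<forall>r P. 0 < r \<and> r < pi \<and> (\<forall>i \<in> {1..n}. P i \<in> sph_circle c r) \<longrightarrow>
       mpoly_eval f (\<lambda>i j. sin (sph_dist (P i) (P j) / 2)) (sin r / 2) = 0}"

end

theory Submission
  imports Defs "HOL-Computational_Algebra.Polynomial"
begin

text \<open>
  If points of a circle correspond to complex units \<open>u\<^sub>i\<close>, then the substituted values are
  \<open>R |u\<^sub>i - u\<^sub>j|\<close> and \<open>R\<close>, where \<open>R\<close> is \<open>r\<^sub>e\<close>, \<open>sinh r\<^sub>h / 2\<close> or \<open>sin r\<^sub>s / 2\<close>. In the Euclidean and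
  hyperbolic cases \<open>R\<close> ranges over all positive reals, so the two conditions coincide. In the
  spherical case \<open>R\<close> is confined to \<open>(0, 1/2]\<close>; but for fixed \<open>u\<^sub>i\<close> the value of the polynomial
  is a univariate polynomial in \<open>R\<close>, which vanishes identically once it vanishes on that interval.
\<close>

section \<open>Evaluation of polynomials\<close>

lemma mpoly_eval_cong:
  assumes "f \<in> polys n"
    and "\<And>i j. 1 \<le> i \<Longrightarrow> i < j \<Longrightarrow> j \<le> n \<Longrightarrow> a i j = a' i j"
  shows "mpoly_eval f a b = mpoly_eval f a' b"
  unfolding mpoly_eval_def
proof (intro sum.cong arg_cong2[where f = "(*)"] prod.cong refl)
  fix m v
  assume "m \<in> Poly_Mapping.keys f" "v \<in> Poly_Mapping.keys m"
  then have "v \<in> insert Y {X i j | i j. 1 \<le> i \<and> i < j \<and> j \<le> n}"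
    using assms(1) unfolding polys_def mpoly_vars_def by blast
  then show "(case v of X i j \<Rightarrow> a i j | Y \<Rightarrow> b) ^ Poly_Mapping.lookup m v =
      (case v of X i j \<Rightarrow> a' i j | Y \<Rightarrow> b) ^ Poly_Mapping.lookup m v"
    using assms(2) by auto
qed

text \<open>Each variable becomes the linear polynomial \<open>[:0, val v:]\<close> in
  \<open>t\<close>, so restricting \<open>f\<close> to a line through the origin gives a univariate
  polynomial. The configuration is fixed and only its size varies.\<close>

lemma mpoly_eval_scale_poly:
  obtains p :: "real poly"
  where "\<And>t. mpoly_eval f (\<lambda>i j. t * a i j) (t * b) = poly p t"
proof -
  define val where "val v = (case v of X i j \<Rightarrow> a i j | Y \<Rightarrow> b)" for v
  define p where "p = (\<Sum>m \<in> Poly_Mapping.keys f. [:Poly_Mapping.lookup f m:] *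
      (\<Prod>v \<in> Poly_Mapping.keys m. [:0, val v:] ^ Poly_Mapping.lookup m v))"
  have "(case v of X i j \<Rightarrow> t * a i j | Y \<Rightarrow> t * b) = t * val v" for v t
    by (simp add: val_def split: pvar.split)
  then have "mpoly_eval f (\<lambda>i j. t * a i j) (t * b) = poly p t" for t
    unfolding mpoly_eval_def p_def by (simp add: poly_sum poly_prod poly_power)
  then show ?thesis
    using that by blast
qed

definition vanishes_on_circles :: "nat \<Rightarrow> real_mpoly \<Rightarrow> real set \<Rightarrow> bool" where
  "vanishes_on_circles n f S \<longleftrightarrow>
     (\<forall>R \<in> S. \<forall>u. (\<forall>i \<in> {1..n}. cmod (u i) = 1) \<longrightarrow>
        mpoly_eval f (\<lambda>i j. R * cmod (u i - u j)) R = 0)"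

lemma vanishes_on_circlesD:
  assumes "vanishes_on_circles n f S" "f \<in> polys n" "R \<in> S"
    and "\<And>i. i \<in> {1..n} \<Longrightarrow> cmod (u i) = 1"
    and "\<And>i j. i \<in> {1..n} \<Longrightarrow> j \<in> {1..n} \<Longrightarrow> a i j = R * cmod (u i - u j)"
  shows "mpoly_eval f a R = 0"
proof -
  have "mpoly_eval f a R = mpoly_eval f (\<lambda>i j. R * cmod (u i - u j)) R"
    by (rule mpoly_eval_cong[OF assms(2)]) (use assms(5) in auto)
  then show ?thesis
    using assms unfolding vanishes_on_circles_def by auto
qed

text \<open>A univariate polynomial with infinitely many roots is zero, so for each fixed
  \<open>u\<close> vanishing spreads from \<open>S\<close> to every real \<open>R\<close>.\<close>

lemma vanishes_on_circles_infinite: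
  assumes "vanishes_on_circles n f S" "infinite S"
  shows "vanishes_on_circles n f T"
  unfolding vanishes_on_circles_def
proof (intro ballI allI impI)
  fix R and u :: "nat \<Rightarrow> complex"
  assume "\<forall>i \<in> {1..n}. cmod (u i) = 1"
  then have zero: "mpoly_eval f (\<lambda>i j. t * cmod (u i - u j)) t = 0" if "t \<in> S" for t
    using assms(1) that unfolding vanishes_on_circles_def by blast
  \<comment> \<open>Taking 1 for the value of \<open>y\<close> makes its scaled value
    \<open>t\<close> itself.\<close>
  obtain p where p: "\<And>t. mpoly_eval f (\<lambda>i j. t * cmod (u i - u j)) (t * 1) = poly p t"
    using mpoly_eval_scale_poly[of f "\<lambda>i j. cmod (u i - u j)" 1] by blast
  have "S \<subseteq> {t. poly p t = 0}"
    using zero p by auto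
  then have "p = 0"
    using assms(2) poly_roots_finite finite_subset by blast
  then show "mpoly_eval f (\<lambda>i j. R * cmod (u i - u j)) R = 0"
    using p[of R] by simp
qed

section \<open>Euclidean circles\<close>

lemma norm_vec2: "norm x = cmod (Complex (x $ 1) (x $ 2))" for x :: "real ^ 2"
  by (simp add: norm_vec_def L2_set_def sum_2 cmod_def)

lemma euclidean_polys_eq:
  "euclidean_polys n = {f \<in> polys n. vanishes_on_circles n f {0<..}}"
proof (intro equalityI subsetI)
  fix f
  assume f: "f \<in> euclidean_polys n"
  have "mpoly_eval f (\<lambda>i j. R * cmod (u i - u j)) R = 0"
    if "R > 0" and u: "\<forall>i \<in> {1..n}. cmod (u i) = 1" for R and u :: "nat \<Rightarrow> complex"
  proof -
    define P :: "nat \<Rightarrow> real ^ 2" where "P i = R *\<^sub>R vector [Re (u i), Im (u i)]" for i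
    have dist_P: "dist (P i) (P j) = R * cmod (u i - u j)" for i j
    proof -
      have "Complex ((P i - P j) $ 1) ((P i - P j) $ 2) = R *\<^sub>R (u i - u j)"
        by (simp add: P_def complex_eq_iff right_diff_distrib)
      then show ?thesis
        using \<open>R > 0\<close> by (simp add: dist_norm norm_vec2)
    qed
    have "P i \<in> sphere 0 R" if "i \<in> {1..n}" for i
    proof -
      have "Complex (P i $ 1) (P i $ 2) = R *\<^sub>R u i"
        by (simp add: P_def complex_eq_iff)
      then show ?thesis
        using u that \<open>R > 0\<close> by (simp add: norm_vec2)
    qed
    then have "mpoly_eval f (\<lambda>i j. dist (P i) (P j)) R = 0"
      using f \<open>R > 0\<close> unfolding euclidean_polys_def by blast
    then show ?thesis
      by (simp add: dist_P)
  qed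
  then show "f \<in> {f \<in> polys n. vanishes_on_circles n f {0<..}}"
    using f by (auto simp: euclidean_polys_def vanishes_on_circles_def)
next
  fix f
  assume "f \<in> {f \<in> polys n. vanishes_on_circles n f {0<..}}"
  then have f: "f \<in> polys n" "vanishes_on_circles n f {0<..}"
    by auto
  have "mpoly_eval f (\<lambda>i j. dist (P i) (P j)) r = 0"
    if "r > 0" and P: "\<forall>i \<in> {1..n}. P i \<in> sphere c r"
    for c :: "real ^ 2" and r P
  proof (rule vanishes_on_circlesD[OF f(2,1)])
    \<comment> \<open>Translating the centre to the origin and dividing by the radius leaves the
      directions.\<close>
    define u where "u i = Complex ((P i - c) $ 1) ((P i - c) $ 2) /\<^sub>R r" for i
    show "cmod (u i) = 1" if "i \<in> {1..n}" for i
      using P that \<open>r > 0\<close> unfolding u_def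
      by (simp only: norm_scaleR norm_vec2[symmetric]) (auto simp: dist_norm norm_minus_commute)
    show "dist (P i) (P j) = r * cmod (u i - u j)" for i j
    proof -
      have "r *\<^sub>R (u i - u j) = Complex ((P i - P j) $ 1) ((P i - P j) $ 2)"
        using \<open>r > 0\<close> by (simp add: u_def complex_eq_iff field_simps)
      then have "norm (r *\<^sub>R (u i - u j)) = dist (P i) (P j)"
        by (simp only: dist_norm norm_vec2)
      then show ?thesis
        using \<open>r > 0\<close> by simp
    qed
  qed (use \<open>r > 0\<close> in auto)
  then show "f \<in> euclidean_polys n"
    using f unfolding euclidean_polys_def by blast
qed

section \<open>Hyperbolic circles\<close>

lemma hyp_dist_nonneg:
  assumes "Im z > 0" "Im w > 0"
  shows "hyp_dist z w \<ge> 0"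
  unfolding hyp_dist_def by (rule arcosh_nonneg_real) (use assms in simp)

text \<open>The identity cosh d = 1 + 2 sinh^2 (d/2) absorbs both the \<open>arcosh\<close> and the
  summand 1 of the distance formula, which leaves an algebraic expression.\<close>

lemma sinh_half_hyp_dist:
  assumes "Im z > 0" "Im w > 0"
  shows "(sinh (hyp_dist z w / 2))\<^sup>2 = (cmod (z - w))\<^sup>2 / (4 * Im z * Im w)"
proof -
  have "cosh (hyp_dist z w) = 1 + (cmod (z - w))\<^sup>2 / (2 * Im z * Im w)"
    unfolding hyp_dist_def by (rule cosh_arcosh_real) (use assms in simp)
  moreover have "cosh (hyp_dist z w) = 2 * (sinh (hyp_dist z w / 2))\<^sup>2 + 1"
    using cosh_double[of "hyp_dist z w / 2"] cosh_square_eq[of "hyp_dist z w / 2"] by simp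
  ultimately show ?thesis
    by (simp add: field_simps)
qed

text \<open>The inverse Cayley transform, from the unit disc onto the upper half-plane with
  \<^term>\<open>0\<close> sent to \<^term>\<open>c\<close>.\<close>

definition cayley :: "complex \<Rightarrow> complex \<Rightarrow> complex" where
  "cayley c w = (c - cnj c * w) / (1 - w)"

lemma cayley_0 [simp]: "cayley c 0 = c"
  by (simp add: cayley_def)

text \<open>Multiplying the numerator by the conjugate of \<open>1 - w\<close> produces the cross
  term \<open>c * cnj w + cnj c * w\<close>, which is real and drops out of the imaginary
  part.\<close>

lemma Im_cayley:
  "Im (cayley c w) = Im c * (1 - (cmod w)\<^sup>2) / (cmod (1 - w))\<^sup>2"
  unfolding cayley_def Im_divide cmod_power2
  by (rule arg_cong2[where f = "(/)"]) (simp_all add: power2_eq_square algebra_simps)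

lemma Im_cayley_pos:
  assumes "Im c > 0" "cmod w < 1"
  shows "Im (cayley c w) > 0"
proof -
  have "w \<noteq> 1" "(cmod w)\<^sup>2 < 1"
    using assms(2) by (auto simp: abs_square_less_1)
  then show ?thesis
    using assms by (simp add: Im_cayley)
qed

lemma sinh_half_hyp_dist_cayley:
  assumes "Im c > 0" "cmod w < 1" "cmod w' < 1"
  shows "(sinh (hyp_dist (cayley c w) (cayley c w') / 2))\<^sup>2 =
    (cmod (w - w'))\<^sup>2 / ((1 - (cmod w)\<^sup>2) * (1 - (cmod w')\<^sup>2))"
proof -
  have ne: "w \<noteq> 1" "w' \<noteq> 1"
    using assms(2,3) by auto
  have "cayley c w - cayley c w' = (c - cnj c) * (w - w') / ((1 - w) * (1 - w'))"
    using ne by (simp add: cayley_def field_simps)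
  moreover have "cmod (c - cnj c) = 2 * Im c"
    using assms(1) by (simp add: complex_diff_cnj norm_mult)
  ultimately have "cmod (cayley c w - cayley c w') =
      2 * Im c * cmod (w - w') / (cmod (1 - w) * cmod (1 - w'))"
    by (simp add: norm_divide norm_mult)
  \<comment> \<open>The cancellation in isolation: \<open>I\<close> is \<open>Im c\<close>,
    \<open>d\<close> is \<open>cmod (w - w')\<close>, \<open>a\<close> and \<open>b\<close> are the
    moduli of \<open>1 - w\<close> and \<open>1 - w'\<close>, and \<open>A\<close> and
    \<open>B\<close> are the numerator factors from \<open>Im_cayley\<close>.\<close>
  moreover have "(2 * I * d / (a * b))\<^sup>2 / (4 * (I * A / a\<^sup>2) * (I * B / b\<^sup>2)) = d\<^sup>2 / (A * B)"
    if "I \<noteq> 0" "a \<noteq> 0" "b \<noteq> 0" for I d a b A B :: real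
    using that by (simp add: power2_eq_square)
  moreover have "Im c \<noteq> 0" "cmod (1 - w) \<noteq> 0" "cmod (1 - w') \<noteq> 0"
    using ne assms by auto
  ultimately show ?thesis
    unfolding sinh_half_hyp_dist[OF Im_cayley_pos[OF assms(1,2)] Im_cayley_pos[OF assms(1,3)]]
    by (simp only: Im_cayley not_False_eq_True)
qed

lemma cayley_surj:
  assumes "Im c > 0" "Im z > 0"
  obtains w where "cmod w < 1" "z = cayley c w"
proof
  define w where "w = (z - c) / (z - cnj c)"
  have ne: "z - cnj c \<noteq> 0"
    using assms by (auto simp: complex_eq_iff)
  \<comment> \<open>Only the imaginary parts contribute to the difference, by (y + v)^2 - (y - v)^2
    = 4yv; hence \<open>z\<close> is nearer to \<open>c\<close> than to its mirror image
    \<open>cnj c\<close>.\<close>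
  have "(cmod (z - c))\<^sup>2 + 4 * (Im z * Im c) = (cmod (z - cnj c))\<^sup>2"
    unfolding cmod_power2 by (simp add: power2_eq_square algebra_simps)
  then have "(cmod (z - c))\<^sup>2 < (cmod (z - cnj c))\<^sup>2"
    using mult_pos_pos[OF assms(2,1)] by linarith
  then have "cmod (z - c) < cmod (z - cnj c)"
    using power_less_imp_less_base by fastforce
  then show "cmod w < 1"
    using ne by (simp add: w_def norm_divide divide_simps)
  have "c - cnj c \<noteq> 0"
    using assms by (auto simp: complex_eq_iff)
  moreover have "1 - w = (c - cnj c) / (z - cnj c)"
    using ne by (simp add: w_def field_simps)
  moreover have "c - cnj c * w = z * (c - cnj c) / (z - cnj c)"
    using ne by (simp add: w_def field_simps)
  ultimately show "z = cayley c w"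
    using ne by (simp add: cayley_def)
qed

text \<open>Since \<open>c\<close> is the image of 0, the distance formula becomes |w|^2 / (1 -
  |w|^2) = sinh^2 (r/2), and solving for |w| gives tanh (r/2). Circles around \<open>c\<close> are
  thus images of Euclidean circles around 0.\<close>

lemma cayley_in_hyp_circle_iff:
  assumes "Im c > 0" "cmod w < 1" "r > 0"
  shows "cayley c w \<in> hyp_circle c r \<longleftrightarrow> cmod w = tanh (r / 2)"
proof -
  let ?d = "hyp_dist c (cayley c w)"
  have "?d = r \<longleftrightarrow> sinh (?d / 2) = sinh (r / 2)"
    by simp
  also have "\<dots> \<longleftrightarrow> (sinh (?d / 2))\<^sup>2 = (sinh (r / 2))\<^sup>2"
    using assms hyp_dist_nonneg[OF assms(1) Im_cayley_pos[OF assms(1,2)]] by simp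
  also have "\<dots> \<longleftrightarrow> (cmod w)\<^sup>2 / (1 - (cmod w)\<^sup>2) = (sinh (r / 2))\<^sup>2"
    using sinh_half_hyp_dist_cayley[OF assms(1) _ assms(2), of 0] by simp
  also have "\<dots> \<longleftrightarrow> (cmod w)\<^sup>2 * (cosh (r / 2))\<^sup>2 = (sinh (r / 2))\<^sup>2"
  proof -
    have "1 - (cmod w)\<^sup>2 \<noteq> 0"
      using assms(2) abs_square_less_1[of "cmod w"] by simp
    then show ?thesis
      by (auto simp: cosh_square_eq field_simps)
  qed
  also have "\<dots> \<longleftrightarrow> (cmod w)\<^sup>2 = (tanh (r / 2))\<^sup>2"
    by (simp add: tanh_def field_simps power_divide)
  also have "\<dots> \<longleftrightarrow> cmod w = tanh (r / 2)"
    using assms(3) by simp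
  finally show ?thesis
    using Im_cayley_pos[OF assms(1,2)] by (simp add: hyp_circle_def hyp_plane_def)
qed

text \<open>Both points have modulus \<open>t\<close> in the disc, so the distance formula has scale
  factor t / (1 - t^2) = sinh (r/2) cosh (r/2) = sinh r / 2. This is where the value substituted for
  \<open>y\<close> comes from.\<close>

lemma sinh_half_hyp_dist_circle:
  assumes "Im c > 0" "r > 0" "cmod u = 1" "cmod v = 1"
  defines "t \<equiv> tanh (r / 2)"
  shows "sinh (hyp_dist (cayley c (t *\<^sub>R u)) (cayley c (t *\<^sub>R v)) / 2) =
    sinh r / 2 * cmod (u - v)"
proof (rule power2_eq_imp_eq)
  have t: "0 < t" "t < 1"
    using assms(2) by (auto simp: t_def tanh_real_lt_1)
  have "(1 - t\<^sup>2) * (cosh (r / 2))\<^sup>2 = (cosh (r / 2))\<^sup>2 - (sinh (r / 2))\<^sup>2"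
    by (simp add: t_def tanh_def power_divide left_diff_distrib)
  then have "(1 - t\<^sup>2) * (cosh (r / 2))\<^sup>2 = 1"
    by (simp add: cosh_square_eq)
  then have "1 - t\<^sup>2 = 1 / (cosh (r / 2))\<^sup>2"
    by (simp add: field_simps)
  moreover have "t = sinh (r / 2) / cosh (r / 2)"
    by (simp add: t_def tanh_def)
  ultimately have "t / (1 - t\<^sup>2) = sinh (r / 2) * cosh (r / 2)"
    by (simp add: power2_eq_square)
  also have "\<dots> = sinh r / 2"
    using sinh_double[of "r / 2"] by simp
  finally have *: "t / (1 - t\<^sup>2) = sinh r / 2" .
  have "cmod (t *\<^sub>R u - t *\<^sub>R v) = t * cmod (u - v)"
    using t by (simp flip: scaleR_diff_right)
  then have "(sinh (hyp_dist (cayley c (t *\<^sub>R u)) (cayley c (t *\<^sub>R v)) / 2))\<^sup>2 =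
      (t * cmod (u - v))\<^sup>2 / ((1 - t\<^sup>2) * (1 - t\<^sup>2))"
    using assms(1,3,4) t by (subst sinh_half_hyp_dist_cayley) auto
  also have "\<dots> = (t / (1 - t\<^sup>2) * cmod (u - v))\<^sup>2"
    by (simp add: power2_eq_square)
  finally show "(sinh (hyp_dist (cayley c (t *\<^sub>R u)) (cayley c (t *\<^sub>R v)) / 2))\<^sup>2 =
      (sinh r / 2 * cmod (u - v))\<^sup>2"
    by (simp only: *)
  show "0 \<le> sinh (hyp_dist (cayley c (t *\<^sub>R u)) (cayley c (t *\<^sub>R v)) / 2)"
    using assms(1,3,4) t by (simp add: hyp_dist_nonneg Im_cayley_pos)
  show "0 \<le> sinh r / 2 * cmod (u - v)"
    using assms(2) by simp
qed

lemma hyperbolic_polys_eq: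
  "hyperbolic_polys n = {f \<in> polys n. vanishes_on_circles n f {0<..}}"
proof (intro equalityI subsetI)
  fix f
  assume f: "f \<in> hyperbolic_polys n"
  then have "f \<in> polys n"
    by (simp add: hyperbolic_polys_def)
  have "mpoly_eval f (\<lambda>i j. R * cmod (u i - u j)) R = 0"
    if "R > 0" and u: "\<forall>i \<in> {1..n}. cmod (u i) = 1" for R and u :: "nat \<Rightarrow> complex"
  proof -
    \<comment> \<open>Chosen so that \<open>sinh r / 2 = R\<close>; every positive \<open>R\<close>
      is reached.\<close>
    define r where "r = arsinh (2 * R)"
    have r: "r > 0" "sinh r = 2 * R"
      using \<open>R > 0\<close> by (auto simp: r_def)
    define P where "P i = cayley \<i> (tanh (r / 2) *\<^sub>R u i)" for i
    have "P i \<in> hyp_circle \<i> r" if "i \<in> {1..n}" for i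
      using u that r unfolding P_def
      by (subst cayley_in_hyp_circle_iff) (auto simp: tanh_real_lt_1)
    then have "mpoly_eval f (\<lambda>i j. sinh (hyp_dist (P i) (P j) / 2)) (sinh r / 2) = 0"
      using f r(1) unfolding hyperbolic_polys_def hyp_plane_def by force
    also have "mpoly_eval f (\<lambda>i j. sinh (hyp_dist (P i) (P j) / 2)) (sinh r / 2) =
        mpoly_eval f (\<lambda>i j. R * cmod (u i - u j)) (sinh r / 2)"
      using u r sinh_half_hyp_dist_circle[of \<i> r]
      by (intro mpoly_eval_cong[OF \<open>f \<in> polys n\<close>]) (simp add: P_def)
    finally show ?thesis
      using r by simp
  qed
  then show "f \<in> {f \<in> polys n. vanishes_on_circles n f {0<..}}"
    using \<open>f \<in> polys n\<close> by (auto simp: vanishes_on_circles_def)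
next
  fix f
  assume "f \<in> {f \<in> polys n. vanishes_on_circles n f {0<..}}"
  then have f: "f \<in> polys n" "vanishes_on_circles n f {0<..}"
    by auto
  have "mpoly_eval f (\<lambda>i j. sinh (hyp_dist (P i) (P j) / 2)) (sinh r / 2) = 0"
    if c: "c \<in> hyp_plane" and "r > 0" and P: "\<forall>i \<in> {1..n}. P i \<in> hyp_circle c r" for c r P
  proof -
    have "Im c > 0"
      using c by (simp add: hyp_plane_def)
    define t where "t = tanh (r / 2)"
    have "t > 0"
      using \<open>r > 0\<close> by (simp add: t_def)
    \<comment> \<open>Pull the point back to the disc, where it has modulus \<open>t\<close>, and
      normalise.\<close>
    have "\<exists>u. cmod u = 1 \<and> P i = cayley c (t *\<^sub>R u)" if "i \<in> {1..n}" for i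
    proof -
      have "Im (P i) > 0"
        using P that by (auto simp: hyp_circle_def hyp_plane_def)
      then obtain w where w: "cmod w < 1" "P i = cayley c w"
        using cayley_surj \<open>Im c > 0\<close> by blast
      then have "cmod w = t"
        using cayley_in_hyp_circle_iff[OF \<open>Im c > 0\<close> w(1) \<open>r > 0\<close>] P that
        unfolding t_def by metis
      then have "cmod (w /\<^sub>R t) = 1 \<and> P i = cayley c (t *\<^sub>R (w /\<^sub>R t))"
        using w \<open>t > 0\<close> by simp
      then show ?thesis
        by blast
    qed
    then obtain u where u: "\<forall>i \<in> {1..n}. cmod (u i) = 1 \<and> P i = cayley c (t *\<^sub>R u i)"
      by metis
    show ?thesis
      by (rule vanishes_on_circlesD[OF f(2,1), of _ u])
        (use u \<open>r > 0\<close> \<open>Im c > 0\<close> sinh_half_hyp_dist_circle in \<open>auto simp: t_def\<close>)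
  qed
  then show "f \<in> hyperbolic_polys n"
    using f unfolding hyperbolic_polys_def by blast
qed

section \<open>Spherical circles\<close>

lemma inner_vec3: "x \<bullet> y = x $ 1 * y $ 1 + x $ 2 * y $ 2 + x $ 3 * y $ 3" for x y :: "real ^ 3"
  by (simp add: inner_vec_def sum_3)

text \<open>On the unit sphere an arc of length d has a chord of length 2 sin (d/2), so the
  substituted values are half the chords in space.\<close>

lemma sin_half_sph_dist:
  assumes "norm p = 1" "norm q = 1"
  shows "sin (sph_dist p q / 2) = dist p q / 2"
proof (rule power2_eq_imp_eq)
  have bounds: "-1 \<le> p \<bullet> q" "p \<bullet> q \<le> 1"
    using Cauchy_Schwarz_ineq2[of p q] assms by auto
  have "1 - 2 * (sin (sph_dist p q / 2))\<^sup>2 = p \<bullet> q"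
    using cos_double_sin[of "sph_dist p q / 2"] cos_arccos[OF bounds] by (simp add: sph_dist_def)
  moreover have "(dist p q)\<^sup>2 = 2 - 2 * (p \<bullet> q)"
    using assms
    by (simp add: dist_norm power2_norm_eq_inner inner_diff inner_commute norm_eq_1)
  ultimately show "(sin (sph_dist p q / 2))\<^sup>2 = (dist p q / 2)\<^sup>2"
    by (simp add: power_divide)
  \<comment> \<open>The \<open>arccos\<close> lies between 0 and pi, so its half lies where the sine
    is nonnegative.\<close>
  show "0 \<le> sin (sph_dist p q / 2)"
    using arccos_lbound[OF bounds] arccos_ubound[OF bounds]
    by (intro sin_ge_zero) (auto simp: sph_dist_def)
qed simp

text \<open>Describes the circle as the section of the sphere by a plane orthogonal to
  \<open>c\<close>; for 0 < r < pi this inverts \<open>arccos\<close> exactly.\<close>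

lemma in_sph_circle_iff:
  assumes "norm c = 1" "0 < r" "r < pi"
  shows "p \<in> sph_circle c r \<longleftrightarrow> norm p = 1 \<and> c \<bullet> p = cos r"
proof -
  have "arccos (c \<bullet> p) = r \<longleftrightarrow> c \<bullet> p = cos r" if "norm p = 1"
  proof -
    have "-1 \<le> c \<bullet> p" "c \<bullet> p \<le> 1"
      using Cauchy_Schwarz_ineq2[of c p] assms that by auto
    then show ?thesis
      using assms by (auto simp: arccos_cos)
  qed
  then show ?thesis
    by (auto simp: sph_circle_def sph_dist_def unit_sphere_def)
qed

lemma spherical_polys_subset:
  "spherical_polys n \<subseteq> {f \<in> polys n. vanishes_on_circles n f {0<..1 / 2}}"
proof
  fix f
  assume f: "f \<in> spherical_polys n"
  then have "f \<in> polys n"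
    by (simp add: spherical_polys_def)
  have "mpoly_eval f (\<lambda>i j. R * cmod (u i - u j)) R = 0"
    if R: "0 < R" "R \<le> 1 / 2" and u: "\<forall>i \<in> {1..n}. cmod (u i) = 1"
    for R and u :: "nat \<Rightarrow> complex"
  proof -
    \<comment> \<open>The bound \<open>R \<le> 1 / 2\<close> makes \<open>arcsin\<close> applicable.
      Of the radii with this sine, the one up to pi/2 suffices.\<close>
    define r where "r = arcsin (2 * R)"
    have sin_r: "sin r = 2 * R"
      using R by (simp add: r_def)
    have r: "0 < r" "r < pi"
      using R arcsin_less_arcsin[of 0 "2 * R"] arcsin_bounded[of "2 * R"] pi_gt_zero
      unfolding r_def by auto
    define c :: "real ^ 3" where "c = vector [0, 0, 1]"
    \<comment> \<open>Points on the parallel at angular distance \<open>r\<close> from the north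
      pole, a Euclidean circle of radius \<open>sin r\<close> at height
      \<open>cos r\<close>.\<close>
    define P :: "nat \<Rightarrow> real ^ 3"
      where "P i = vector [sin r * Re (u i), sin r * Im (u i), cos r]" for i
    have c: "norm c = 1"
      by (simp add: c_def norm_eq_1 inner_vec3)
    have norm_P: "norm (P i) = 1" if "i \<in> {1..n}" for i
    proof -
      have "(Re (u i))\<^sup>2 + (Im (u i))\<^sup>2 = 1"
        using u that cmod_power2[of "u i"] by simp
      moreover have "P i \<bullet> P i = (sin r)\<^sup>2 * ((Re (u i))\<^sup>2 + (Im (u i))\<^sup>2) + (cos r)\<^sup>2"
        by (simp add: P_def inner_vec3 power2_eq_square algebra_simps)
      ultimately show ?thesis
        by (simp add: norm_eq_1)
    qed
    have dist_P: "dist (P i) (P j) = sin r * cmod (u i - u j)" for i j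
    proof (rule power2_eq_imp_eq)
      have "(dist (P i) (P j))\<^sup>2 = (P i - P j) \<bullet> (P i - P j)"
        by (simp add: dist_norm power2_norm_eq_inner)
      then show "(dist (P i) (P j))\<^sup>2 = (sin r * cmod (u i - u j))\<^sup>2"
        unfolding power_mult_distrib cmod_power2
        by (simp add: P_def inner_vec3 power2_eq_square algebra_simps)
    qed (use R sin_r in auto)
    have "P i \<in> sph_circle c r" if "i \<in> {1..n}" for i
      using norm_P[OF that] r c by (simp add: in_sph_circle_iff) (simp add: c_def P_def inner_vec3)
    then have "mpoly_eval f (\<lambda>i j. sin (sph_dist (P i) (P j) / 2)) (sin r / 2) = 0"
      using f r c unfolding spherical_polys_def unit_sphere_def by force
    also have "mpoly_eval f (\<lambda>i j. sin (sph_dist (P i) (P j) / 2)) (sin r / 2) =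
        mpoly_eval f (\<lambda>i j. R * cmod (u i - u j)) (sin r / 2)"
      by (intro mpoly_eval_cong[OF \<open>f \<in> polys n\<close>])
        (simp add: sin_half_sph_dist norm_P dist_P sin_r)
    finally show ?thesis
      using sin_r by simp
  qed
  then show "f \<in> {f \<in> polys n. vanishes_on_circles n f {0<..1 / 2}}"
    using \<open>f \<in> polys n\<close> by (auto simp: vanishes_on_circles_def)
qed

text \<open>After an orthogonal transformation taking the centre to the north pole, the circle is
  horizontal with Euclidean radius \<open>sin r\<close>, so its chords are \<open>sin r\<close>
  times distances of complex units.\<close>

lemma spherical_polys_superset:
  "{f \<in> polys n. vanishes_on_circles n f {0<..}} \<subseteq> spherical_polys n"
proof
  fix f
  assume "f \<in> {f \<in> polys n. vanishes_on_circles n f {0<..}}"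
  then have f: "f \<in> polys n" "vanishes_on_circles n f {0<..}"
    by auto
  have "mpoly_eval f (\<lambda>i j. sin (sph_dist (P i) (P j) / 2)) (sin r / 2) = 0"
    if c: "c \<in> unit_sphere" and r: "0 < r" "r < pi"
      and P: "\<forall>i \<in> {1..n}. P i \<in> sph_circle c r" for c r P
  proof -
    have norm_c: "norm c = 1"
      using c by (simp add: unit_sphere_def)
    then have P: "norm (P i) = 1" "c \<bullet> P i = cos r" if "i \<in> {1..n}" for i
      using P in_sph_circle_iff r that by blast+
    have "sin r > 0"
      using r by (simp add: sin_gt_zero)
    define k :: "real ^ 3" where "k = vector [0, 0, 1]"
    have "norm k = 1"
      by (simp add: k_def norm_eq_1 inner_vec3)
    then obtain T where T: "orthogonal_transformation T" "T c = k"
      using orthogonal_transformation_exists[of c k] norm_c by auto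
    have linT: "linear T" and innerT: "\<And>x y. T x \<bullet> T y = x \<bullet> y"
      using T(1) by (auto simp: orthogonal_transformation_def)
    \<comment> \<open>Horizontal projection of the moved point, rescaled to the unit circle.\<close>
    define u where "u i = Complex (T (P i) $ 1) (T (P i) $ 2) /\<^sub>R sin r" for i
    have third: "T (P i) $ 3 = cos r" if "i \<in> {1..n}" for i
      using P(2)[OF that] innerT[of c "P i"] T(2) by (simp add: k_def inner_vec3)
    have unit: "cmod (u i) = 1" if "i \<in> {1..n}" for i
    proof -
      have "T (P i) \<bullet> T (P i) = 1"
        using P(1)[OF that] innerT[of "P i" "P i"] by (simp add: norm_eq_1)
      then have "(T (P i) $ 1)\<^sup>2 + (T (P i) $ 2)\<^sup>2 = (sin r)\<^sup>2"
        using third[OF that] sin_squared_eq[of r] by (simp add: inner_vec3 power2_eq_square)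
      then have "cmod (Complex (T (P i) $ 1) (T (P i) $ 2)) = sin r"
        using \<open>sin r > 0\<close> by (simp add: cmod_def)
      then show ?thesis
        using \<open>sin r > 0\<close> unfolding u_def norm_scaleR by simp
    qed
    have "dist (P i) (P j) = sin r * cmod (u i - u j)" if "i \<in> {1..n}" "j \<in> {1..n}" for i j
    proof -
      have "sin r *\<^sub>R (u i - u j) =
          Complex (T (P i) $ 1 - T (P j) $ 1) (T (P i) $ 2 - T (P j) $ 2)"
        using \<open>sin r > 0\<close> by (simp add: u_def complex_eq_iff field_simps)
      then have "sin r * cmod (u i - u j) =
          cmod (Complex (T (P i) $ 1 - T (P j) $ 1) (T (P i) $ 2 - T (P j) $ 2))"
        using \<open>sin r > 0\<close> by (metis abs_of_pos norm_scaleR)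
      \<comment> \<open>All third coordinates equal \<open>cos r\<close>, so the projection loses no
        distance.\<close>
      also have "\<dots> = norm (T (P i) - T (P j))"
        using third[OF that(1)] third[OF that(2)]
        by (simp add: norm_eq_sqrt_inner[of "T (P i) - T (P j)"] inner_vec3 cmod_def power2_eq_square)
      also have "\<dots> = dist (P i) (P j)"
        by (simp add: dist_norm norm_eq_sqrt_inner innerT flip: linear_diff[OF linT])
      finally show ?thesis
        by simp
    qed
    then show ?thesis
      by (intro vanishes_on_circlesD[OF f(2,1), of _ u])
        (use unit P(1) \<open>sin r > 0\<close> in \<open>auto simp: sin_half_sph_dist\<close>)
  qed
  then show "f \<in> spherical_polys n"
    using f unfolding spherical_polys_def by blast
qed

theorem theorem1:
  fixes n :: nat
  assumes "n \<ge> 3"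
  shows "euclidean_polys n = hyperbolic_polys n \<and> hyperbolic_polys n = spherical_polys n"
proof -
  \<comment> \<open>Closes the chain of inclusions: vanishing for all \<open>R > 0\<close> gives
    membership in \<open>spherical_polys n\<close>, which gives vanishing on this interval and hence
    again for all \<open>R > 0\<close>.\<close>
  have "infinite {0<..1 / 2 :: real}"
    by (simp add: infinite_Ioc)
  then have "spherical_polys n \<subseteq> {f \<in> polys n. vanishes_on_circles n f {0<..}}"
    using spherical_polys_subset[of n] vanishes_on_circles_infinite by blast
  then show ?thesis
    using spherical_polys_superset[of n] euclidean_polys_eq hyperbolic_polys_eq by blast
qed

end
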